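(* Let $t$ and $l$ be positive integers. Then: (1) The number of $t$-core partitions into $l$ parts is $\binom{l+t-2}{l}$. (2) The number of $t$-core partitions into at most $l$ parts (the empty partition included) is $\binom{l+t-1}{l}$. (3) The number of $t$-core partitions with $l$ parts greater than $1$ and $j$ parts equal to $1$ is $$\begin{cases}\binom{l+t-3}{l} & \text{if } 0\le j\le t-2,\\ \binom{l+t-2}{l} & \text{if } j=t-1,\\ 0 & \text{if } j>t-1.\end{cases}$$ (4) The number of $t$-core partitions into $l$ parts such that the smallest part equals $i$ is $\binom{l+t-i-2}{l-1}$.
   Context: A partition is a finite nonincreasing sequence $\lambda=(\lambda_1,\dots,\lambda_l)$ of positive integers; the $\lambda_i$ are its parts, and "into $l$ parts" means into exactly $l$ parts. The empty partition $\emptyset$ (no parts) is regarded as a partition which is a $t$-core for every $t$. The Ferrers diagram of $\lambda$ has $\lambda_j$ nodes in row $j$ (left justified). The hook length of a node is the number of nodes consisting of the node itself, the nodes to its right in the same row and the nodes below it in the same column. $\lambda$ is a $t$-core partition if no node has hook length $t$ (equivalently, no hook length is divisible by $t$). In (3), $j$ is a nonnegative integer; in (4), $i$ is a positive integer. A binomial coefficient $\binom{n}{k}$ with integers $n$ and $k\ge 0$ is read as $0$ when $n<k$ (including negative $n$). *)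

theory Defs
  imports Main
begin

definition is_partition :: "nat list \<Rightarrow> bool" where
  "is_partition xs \<longleftrightarrow> sorted_wrt (\<ge>) xs \<and> (\<forall>x \<in> set xs. 0 < x)"

text \<open>Rows and columns of the Ferrers diagram are numbered from 0.\<close>

definition ferrers :: "nat list \<Rightarrow> (nat \<times> nat) set" where
  "ferrers xs = {(r, c). r < length xs \<and> c < xs ! r}"

definition hook :: "nat list \<Rightarrow> nat \<times> nat \<Rightarrow> (nat \<times> nat) set" where
  "hook xs v = {(r, c) \<in> ferrers xs.
     (r = fst v \<and> snd v \<le> c) \<or> (c = snd v \<and> fst v \<le> r)}"

definition hook_length :: "nat list \<Rightarrow> nat \<times> nat \<Rightarrow> nat" where
  "hook_length xs v = card (hook xs v)"

definition core_partition :: "nat \<Rightarrow> nat list \<Rightarrow> bool" where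
  "core_partition t xs \<longleftrightarrow>
     is_partition xs \<and> (\<forall>v \<in> ferrers xs. hook_length xs v \<noteq> t)"

text \<open>The binomial coefficient with integer upper index, read as 0 whenever \<open>n < k\<close>;
  it therefore differs from \<open>gchoose\<close> for negative \<open>n\<close>,
  for example \<open>ibinom (- 1) 0 = 0\<close>.\<close>

definition ibinom :: "int \<Rightarrow> nat \<Rightarrow> nat" where
  "ibinom n k = (if n < int k then 0 else nat n choose k)"

text \<open>``The number of elements of \<open>A\<close> is \<open>n\<close>''; \<^const>\<open>card\<close> alone would be 0
  on an infinite set, so finiteness is part of the claim.\<close>

definition has_number :: "'a set \<Rightarrow> nat \<Rightarrow> bool" where
  "has_number A n \<longleftrightarrow> finite A \<and> card A = n"

end

theory Submission
  imports Defs
begin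

text \<open>
  A partition with \<open>n\<close> parts is determined by the hook lengths \<open>B\<close> of its first column, which can be
  any set of \<open>n\<close> positive integers.  The hook lengths of the row whose first hook length is \<open>b\<close> are
  the numbers \<open>b - y\<close> with \<open>0 \<le> y < b\<close> and \<open>y \<notin> B\<close> (lemma \<open>hook_length_in_row_iff\<close>).  Hence the
  partition is a \<open>t\<close>-core iff \<open>b \<in> B\<close> and \<open>t \<le> b\<close> imply \<open>b - t \<in> B\<close>; as \<open>0 \<notin> B\<close>, this forbids
  multiples of \<open>t\<close> in \<open>B\<close>.

  Such a set meets each residue class \<open>1, \<dots>, t - 1\<close> modulo \<open>t\<close> in an initial segment: picture
  beads pushed to the top of the runners of an abacus.  So a \<open>t\<close>-core amounts to a vector of \<open>t - 1\<close>
  natural numbers, the lengths of these segments, and the sum of the vector is the number of parts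
  (lemmas \<open>bij_betw_core_vector\<close> and \<open>sum_list_core_vector\<close>).  The first two counts are now
  stars and bars, with a slack entry for ``at most''.

  The other two counts only prescribe which of the runners near the start of the abacus are empty.
  A partition has exactly \<open>j\<close> parts equal to 1 iff \<open>1, \<dots>, j\<close> are in \<open>B\<close> and \<open>j + 1\<close> is not: the first
  \<open>j\<close> runners are nonempty, and the next one, if there is one, is empty.  Its smallest part is
  \<open>min B\<close>, and this equals \<open>i\<close> iff runner \<open>i\<close> is the first nonempty one.  Subtracting 1 from
  the entries known to be positive and deleting those known to be 0 leads back to stars and bars.
\<close>

section \<open>First-column hook lengths\<close>

text \<open>
  Row \<open>k\<close> contributes its \<open>xs ! k\<close> nodes and the \<open>length xs - 1 - k\<close> nodes of the first column
  below it.  These numbers are also known as a beta-set of the partition.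
\<close>

definition first_column_hooks :: "nat list \<Rightarrow> nat set" where
  "first_column_hooks xs = (\<lambda>k. xs ! k + (length xs - 1 - k)) ` {..<length xs}"

lemma first_column_hooks_iff:
  "y \<in> first_column_hooks xs \<longleftrightarrow> (\<exists>k < length xs. y = xs ! k + (length xs - 1 - k))"
  unfolding first_column_hooks_def by blast

lemma finite_first_column_hooks [simp]: "finite (first_column_hooks xs)"
  by (simp add: first_column_hooks_def)

lemma first_column_hooks_Nil [simp]: "first_column_hooks [] = {}"
  by (simp add: first_column_hooks_def)

lemma first_column_hooks_Cons [simp]:
  "first_column_hooks (x # xs) = insert (x + length xs) (first_column_hooks xs)"
proof -
  have "{..<length (x # xs)} = insert 0 (Suc ` {..<length xs})"
    by (simp add: lessThan_Suc_eq_insert_0)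
  then show ?thesis
    by (simp add: first_column_hooks_def image_image del: lessThan_Suc)
qed

lemma is_partition_Nil [simp]: "is_partition []"
  by (simp add: is_partition_def)

lemma is_partition_Cons [simp]:
  "is_partition (x # xs) \<longleftrightarrow> 0 < x \<and> (\<forall>y \<in> set xs. y \<le> x) \<and> is_partition xs"
  by (auto simp: is_partition_def)

lemma first_column_hooks_less:
  assumes "is_partition (x # xs)" and "y \<in> first_column_hooks xs"
  shows "y < x + length xs"
proof -
  from assms(2) obtain k where k: "k < length xs" "y = xs ! k + (length xs - 1 - k)"
    by (auto simp: first_column_hooks_def)
  then have "xs ! k \<le> x" using assms(1) by simp
  then show ?thesis using k by simp
qed

lemma card_first_column_hooks:
  "is_partition xs \<Longrightarrow> card (first_column_hooks xs) = length xs"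
proof (induction xs)
  case (Cons x xs)
  then have "x + length xs \<notin> first_column_hooks xs"
    using first_column_hooks_less by blast
  then show ?case using Cons by simp
qed simp

lemma zero_notin_first_column_hooks:
  "is_partition xs \<Longrightarrow> 0 \<notin> first_column_hooks xs"
  by (induction xs) auto

lemma Max_first_column_hooks:
  assumes "is_partition (x # xs)"
  shows "Max (first_column_hooks (x # xs)) = x + length xs"
  using first_column_hooks_less[OF assms] by (intro Max_eqI) (auto intro: less_imp_le)

text \<open>
  The set determines the number of parts as its cardinality and then the largest part from its
  maximum, so the parts can be recovered one after the other.
\<close>

lemma inj_on_first_column_hooks: "inj_on first_column_hooks {xs. is_partition xs}"
proof (rule inj_onI, unfold mem_Collect_eq)
  fix xs ys
  assume "is_partition xs" "is_partition ys" "first_column_hooks xs = first_column_hooks ys"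
  then show "xs = ys"
  proof (induction xs arbitrary: ys)
    case Nil
    then show ?case by (cases ys) auto
  next
    case (Cons x xs)
    then obtain y zs where ys: "ys = y # zs" by (cases ys) auto
    have len: "length xs = length zs"
      using card_first_column_hooks[OF Cons.prems(1)] card_first_column_hooks[OF Cons.prems(2)]
        Cons.prems(3) ys by simp
    have "x + length xs = y + length zs"
      using Max_first_column_hooks[of x xs] Max_first_column_hooks[of y zs] Cons.prems ys by simp
    with len have "x = y" by simp
    have "x + length xs \<notin> first_column_hooks xs" "y + length zs \<notin> first_column_hooks zs"
      using first_column_hooks_less Cons.prems ys by blast+
    then have "first_column_hooks xs = first_column_hooks zs"
      using Cons.prems(3) ys len \<open>x = y\<close> by (auto simp: insert_ident)
    then show ?case using Cons ys \<open>x = y\<close> by simp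
  qed
qed

text \<open>
  Adding an element \<open>b\<close> above all others means adding a largest part \<open>b - length xs\<close> in front; since
  \<open>b\<close> exceeds the old maximum, this part is at least as large as the old first part.
\<close>

lemma partition_with_first_column_hooks:
  assumes "finite B" and "0 \<notin> B"
  shows "\<exists>xs. is_partition xs \<and> first_column_hooks xs = B"
  using assms
proof (induction B rule: finite_linorder_max_induct)
  case empty
  then show ?case by (intro exI[of _ "[]"]) simp
next
  case (insert b B)
  then obtain xs where xs: "is_partition xs" "first_column_hooks xs = B" by auto
  have bound: "y + length xs \<le> b" if "y \<in> set xs" for y
  proof -
    from that obtain z zs where zs: "xs = z # zs" by (cases xs) auto
    then have "z + length zs < b" using insert.hyps xs by auto
    moreover have "y \<le> z" using that zs xs by auto
    ultimately show ?thesis using zs by simp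
  qed
  have "length xs < b"
  proof (cases xs)
    case Nil
    then show ?thesis using insert.prems by simp
  next
    case (Cons z zs)
    then show ?thesis using bound[of z] xs by simp
  qed
  then have "is_partition ((b - length xs) # xs)" and
    "first_column_hooks ((b - length xs) # xs) = insert b B"
    using xs bound by (auto simp: le_diff_conv2)
  then show ?case by blast
qed

lemma count_one_eq_length:
  assumes "is_partition (1 # xs)"
  shows "count_list xs 1 = length xs"
  using assms by (induction xs) auto

text \<open>
  The parts equal to 1 stand at the end and yield \<open>1, \<dots>, j\<close>.  Any larger part stands above them and
  yields at least \<open>j + 2\<close>.
\<close>

lemma first_column_hooks_count_one:
  assumes "is_partition xs"
  shows "{1..count_list xs 1} \<subseteq> first_column_hooks xs"
    and "Suc (count_list xs 1) \<notin> first_column_hooks xs"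
  using assms
proof (induction xs)
  case (Cons x xs)
  {
    case 1
    show ?case
    proof (cases "x = 1")
      case True
      then have "count_list xs 1 = length xs"
        using 1 count_one_eq_length by blast
      then show ?thesis using Cons.IH(1) 1 True by (auto simp: atLeastAtMostSuc_conv)
    qed (use Cons.IH(1) 1 in auto)
  next
    case 2
    have "count_list xs 1 \<le> length xs" by (rule count_le_length)
    moreover have "count_list xs 1 = length xs" if "x = 1"
      using 2 that count_one_eq_length by blast
    moreover have "Suc (Suc (length xs)) \<notin> first_column_hooks xs" if "x = 1"
      using 2 that first_column_hooks_less[of x xs] by fastforce
    ultimately show ?case using Cons.IH(2) 2 by auto
  }
qed auto

text \<open>
  Only one \<open>j\<close> can satisfy the right-hand side, so the two properties above characterise the number
  of parts equal to 1.
\<close>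

lemma count_one_eq_iff:
  assumes "is_partition xs"
  shows "count_list xs 1 = j \<longleftrightarrow>
    {1..j} \<subseteq> first_column_hooks xs \<and> Suc j \<notin> first_column_hooks xs"
proof
  assume j: "{1..j} \<subseteq> first_column_hooks xs \<and> Suc j \<notin> first_column_hooks xs"
  let ?c = "count_list xs 1"
  have "\<not> ?c < j"
    using j first_column_hooks_count_one(2)[OF assms] by (auto simp: subset_eq Suc_le_eq)
  moreover have "\<not> j < ?c"
    using j first_column_hooks_count_one(1)[OF assms] by (auto simp: subset_eq Suc_le_eq)
  ultimately show "?c = j" by simp
qed (use first_column_hooks_count_one[OF assms] in blast)

text \<open>The minimum comes from the last row, where no nodes lie below the first one.\<close>

lemma Min_first_column_hooks:
  assumes "is_partition xs" and "xs \<noteq> []"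
  shows "Min (first_column_hooks xs) = Min (set xs)"
  using assms
proof (induction xs)
  case (Cons x xs)
  show ?case
  proof (cases "xs = []")
    case False
    then have ne: "first_column_hooks xs \<noteq> {}"
      by (auto simp: first_column_hooks_def)
    have "Min (first_column_hooks xs) \<in> first_column_hooks xs"
      using ne by (intro Min_in) auto
    then have "Min (first_column_hooks xs) < x + length xs"
      using first_column_hooks_less Cons.prems by blast
    moreover have "Min (set xs) \<le> x"
      using Cons.prems False by (meson Min_in List.finite_set is_partition_Cons set_empty)
    moreover have "Min (first_column_hooks xs) = Min (set xs)"
      using Cons False by simp
    ultimately show ?thesis using False ne by (simp add: min_absorb2 del: Min_le_iff Min_ge_iff)
  qed simp
qed simp

section \<open>Cores in terms of first-column hook lengths\<close>

lemma downward_closed_eq_lessThan_card: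
  fixes S :: "nat set"
  assumes "finite S" and "\<And>q q'. q \<in> S \<Longrightarrow> q' \<le> q \<Longrightarrow> q' \<in> S"
  shows "S = {..<card S}"
proof (cases "S = {}")
  case False
  then have "Max S \<in> S" using assms(1) by simp
  then have "S = {..Max S}" using assms by (auto intro: Max_ge)
  then have "S = {..<Suc (Max S)}" by (simp add: lessThan_Suc_atMost)
  then show ?thesis by (metis card_lessThan)
qed simp

text \<open>
  This supplies the length of a column of a Ferrers diagram, and likewise the number of
  first-column hook lengths above a given value.
\<close>

lemma decreasing_predicate_cut:
  assumes "\<And>k k'. k < n \<Longrightarrow> P k \<Longrightarrow> k' \<le> k \<Longrightarrow> P k'"
  obtains m where "m \<le> n" and "\<And>k::nat. k < n \<Longrightarrow> P k \<longleftrightarrow> k < m"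
proof -
  let ?S = "{k. k < n \<and> P k}"
  have "?S = {..<card ?S}"
    by (rule downward_closed_eq_lessThan_card) (auto intro: assms)
  then have "P k \<longleftrightarrow> k < card ?S" if "k < n" for k
    using that by blast
  moreover have "card ?S \<le> n"
    using card_mono[of "{..<n}" ?S] by auto
  ultimately show ?thesis using that by blast
qed

lemma partition_nth_mono:
  assumes "is_partition xs" and "k \<le> k'" and "k' < length xs"
  shows "xs ! k' \<le> xs ! k"
  using assms sorted_wrt_nth_less[of "(\<ge>)" xs k k']
  by (cases "k = k'") (auto simp: is_partition_def)

text \<open>Here \<open>m\<close> is the length of column \<open>c\<close>; the two summands count the row part (including
  the corner) and the column part of the hook.\<close>

lemma hook_length_column:
  assumes col: "\<And>k. k < length xs \<Longrightarrow> c < xs ! k \<longleftrightarrow> k < m"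
    and "m \<le> length xs" and "r < m"
  shows "hook_length xs (r, c) = (xs ! r - c) + (m - 1 - r)"
proof -
  have "hook xs (r, c) = {r} \<times> {c..<xs ! r} \<union> {Suc r..<m} \<times> {c}"
    using assms by (fastforce simp: hook_def ferrers_def)
  moreover have "card ({r} \<times> {c..<xs ! r} \<union> {Suc r..<m} \<times> {c})
      = card ({r} \<times> {c..<xs ! r}) + card ({Suc r..<m} \<times> {c})"
    by (rule card_Un_disjoint) auto
  ultimately show ?thesis by (simp add: hook_length_def card_cartesian_product)
qed

text \<open>
  If column \<open>c\<close> has length \<open>m\<close>, then the hook length at \<open>(r, c)\<close> is \<open>b - y\<close> for
  \<open>y = c + (n - m)\<close>, where \<open>n\<close> is the number of parts.  This \<open>y\<close> depends on the column only.  It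
  separates the first-column hook lengths of the \<open>m\<close> rows that reach column \<open>c\<close>, which are larger,
  from those of the other rows, which are smaller.  So \<open>y\<close> is a gap of the set, and conversely every
  gap \<open>y\<close> below \<open>b\<close> arises from a column in this way.
\<close>

lemma hook_length_in_row_iff:
  assumes part: "is_partition xs" and "r < length xs" and "0 < t"
  defines "b \<equiv> xs ! r + (length xs - 1 - r)"
  shows "(\<exists>c. (r, c) \<in> ferrers xs \<and> hook_length xs (r, c) = t) \<longleftrightarrow>
    t \<le> b \<and> b - t \<notin> first_column_hooks xs"
proof
  let ?n = "length xs"
  assume "\<exists>c. (r, c) \<in> ferrers xs \<and> hook_length xs (r, c) = t"
  then obtain c where c: "c < xs ! r" "hook_length xs (r, c) = t"
    by (auto simp: ferrers_def)
  obtain m where m: "m \<le> ?n" "\<And>k. k < ?n \<Longrightarrow> c < xs ! k \<longleftrightarrow> k < m"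
    using decreasing_predicate_cut[of ?n "\<lambda>k. c < xs ! k"] partition_nth_mono[OF part]
    by (metis order.strict_trans2)
  have "r < m" using m c assms by blast
  have "t = (xs ! r - c) + (m - 1 - r)"
    using hook_length_column[of xs c m r] m c(2) \<open>r < m\<close> by blast
  then have b: "b = t + (?n - m + c)"
    using \<open>r < m\<close> m(1) c(1) unfolding b_def by linarith
  have "?n - m + c \<notin> first_column_hooks xs"
  proof
    assume "?n - m + c \<in> first_column_hooks xs"
    then obtain k where k: "k < ?n" "?n - m + c = xs ! k + (?n - 1 - k)"
      unfolding first_column_hooks_iff by blast
    show False
    proof (cases "k < m")
      case True
      then show ?thesis using m(2)[OF k(1)] m(1) k by linarith
    next
      case False
      then show ?thesis using m(2)[OF k(1)] m(1) k by linarith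
    qed
  qed
  then show "t \<le> b \<and> b - t \<notin> first_column_hooks xs"
    using b by simp
next
  let ?n = "length xs"
  let ?b = "\<lambda>k. xs ! k + (?n - 1 - k)"
  assume b: "t \<le> b \<and> b - t \<notin> first_column_hooks xs"
  define y where "y = b - t"
  have y: "?b k \<noteq> y" if "k < ?n" for k
    using b that unfolding first_column_hooks_iff y_def by metis
  have anti: "?b k \<le> ?b k'" if "k < ?n" "k' \<le> k" for k k'
    using partition_nth_mono[OF part that(2,1)] that by linarith
  obtain m where m: "m \<le> ?n" "\<And>k. k < ?n \<Longrightarrow> y < ?b k \<longleftrightarrow> k < m"
    using decreasing_predicate_cut[of ?n "\<lambda>k. y < ?b k"] anti
    by (metis order.strict_trans2)
  have "y < ?b r" using b \<open>0 < t\<close> unfolding y_def b_def by linarith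
  then have "r < m" using m assms by blast
  \<comment> \<open>Below the gap \<open>y\<close> lie the distinct values of the last \<open>?n - m\<close> rows.\<close>
  have ge: "?n - m \<le> y"
    using m(2)[of m] y[of m] m(1) by (cases "m < ?n") auto
  define c where "c = y - (?n - m)"
  have col: "c < xs ! k \<longleftrightarrow> k < m" if k: "k < ?n" for k
  proof (cases "k < m")
    case True
    have "y < ?b (m - 1)" using m(2)[of "m - 1"] m(1) True by linarith
    then have "c < xs ! (m - 1)" using ge m(1) True unfolding c_def by linarith
    then show ?thesis using partition_nth_mono[OF part, of k "m - 1"] True m(1) by linarith
  next
    case False
    then have "m < ?n" using k by simp
    then have "?b m < y" using m(2)[of m] y[of m] by simp
    then have "xs ! m \<le> c" using ge \<open>m < ?n\<close> unfolding c_def by linarith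
    then show ?thesis using partition_nth_mono[OF part, of m k] False k by simp
  qed
  have "c < xs ! r" using col \<open>r < m\<close> assms by blast
  moreover have "(xs ! r - c) + (m - 1 - r) = t"
  proof -
    have "c + (?n - m) + t = b" using ge b unfolding c_def y_def by linarith
    moreover have "b = xs ! r + ((?n - m) + (m - 1 - r))"
      using m(1) \<open>r < m\<close> by (simp add: b_def)
    ultimately show ?thesis using \<open>c < xs ! r\<close> by linarith
  qed
  then have "hook_length xs (r, c) = t"
    using hook_length_column[OF col m(1) \<open>r < m\<close>] by simp
  ultimately show "\<exists>c. (r, c) \<in> ferrers xs \<and> hook_length xs (r, c) = t"
    using assms by (auto simp: ferrers_def)
qed

definition subtraction_closed :: "nat \<Rightarrow> nat set \<Rightarrow> bool" where
  "subtraction_closed t B \<longleftrightarrow> finite B \<and> 0 \<notin> B \<and> (\<forall>x \<in> B. t \<le> x \<longrightarrow> x - t \<in> B)"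

text \<open>
  The case \<open>b = t\<close> needs no separate condition: \<open>b - t = 0\<close> is never a first-column hook length, so
  closure under subtraction excludes \<open>t\<close> itself.
\<close>

lemma core_partition_iff:
  assumes "0 < t"
  shows "core_partition t xs \<longleftrightarrow>
    is_partition xs \<and> subtraction_closed t (first_column_hooks xs)"
proof (cases "is_partition xs")
  case True
  have "(\<forall>v \<in> ferrers xs. hook_length xs v \<noteq> t) \<longleftrightarrow>
    (\<forall>r < length xs. \<not> (\<exists>c. (r, c) \<in> ferrers xs \<and> hook_length xs (r, c) = t))"
    by (auto simp: ferrers_def)
  also have "\<dots> \<longleftrightarrow> subtraction_closed t (first_column_hooks xs)"
    using hook_length_in_row_iff[OF True _ assms] zero_notin_first_column_hooks[OF True]
    by (auto simp: subtraction_closed_def) (auto simp: first_column_hooks_def)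
  finally show ?thesis using True by (simp add: core_partition_def)
qed (simp add: core_partition_def)

section \<open>The abacus\<close>

text \<open>
  Runner \<open>i\<close> (counted from 0) carries the positions congruent to \<open>Suc i\<close> modulo \<open>t\<close>.  The class of 0
  gets no runner, since no multiple of \<open>t\<close> occurs in a set closed under subtraction of \<open>t\<close>.
\<close>

definition runner_lengths :: "nat \<Rightarrow> nat set \<Rightarrow> nat list" where
  "runner_lengths t B = map (\<lambda>i. card {q. Suc i + q * t \<in> B}) [0..<t - 1]"

definition abacus :: "nat \<Rightarrow> nat list \<Rightarrow> nat set" where
  "abacus t as = (\<lambda>(i, q). Suc i + q * t) ` (SIGMA i:{..<t - 1}. {..<as ! i})"

lemma runner_position_mod:
  assumes "i < t - 1"
  shows "(Suc i + q * t) mod t = Suc i"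
  using assms by (simp del: add_Suc)

lemma runner_position_eq_iff:
  assumes "i < t - 1" and "i' < t - 1"
  shows "Suc i + q * t = Suc i' + q' * t \<longleftrightarrow> i = i' \<and> q = q'"
proof
  assume eq: "Suc i + q * t = Suc i' + q' * t"
  then have "i = i'" using runner_position_mod assms by (metis Suc_inject)
  with eq assms show "i = i' \<and> q = q'" by auto
qed simp

lemma length_runner_lengths [simp]: "length (runner_lengths t B) = t - 1"
  by (simp add: runner_lengths_def)

text \<open>Closure under subtraction lets beads slide up, so that the beads on a runner form an initial
  segment, which is known once its length is.\<close>

lemma nth_runner_lengths:
  assumes "0 < t" and closed: "subtraction_closed t B" and "i < t - 1"
  shows "q < runner_lengths t B ! i \<longleftrightarrow> Suc i + q * t \<in> B"
proof -
  let ?S = "{q. Suc i + q * t \<in> B}"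
  have "inj (\<lambda>q. Suc i + q * t)" using \<open>0 < t\<close> by (auto simp: inj_def)
  then have "finite ((\<lambda>q. Suc i + q * t) -` B)"
    using closed by (intro finite_vimageI) (auto simp: subtraction_closed_def)
  then have "finite ?S" by (simp add: vimage_def)
  moreover have "q' \<in> ?S" if "q \<in> ?S" "q' \<le> q" for q q'
    using that(2,1)
  proof (induction rule: inc_induct)
    case (step q')
    then have "Suc i + Suc q' * t \<in> B" by simp
    then have "Suc i + Suc q' * t - t \<in> B"
      using closed by (auto simp: subtraction_closed_def)
    then show ?case by simp
  qed
  ultimately have "?S = {..<card ?S}"
    by (rule downward_closed_eq_lessThan_card)
  then show ?thesis using assms by (auto simp: runner_lengths_def)
qed

lemma Suc_mem_abacus_iff:
  assumes "i < t - 1"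
  shows "Suc i + q * t \<in> abacus t as \<longleftrightarrow> q < as ! i"
proof
  assume "Suc i + q * t \<in> abacus t as"
  then obtain i' q' where *: "Suc i + q * t = Suc i' + q' * t" "i' < t - 1" "q' < as ! i'"
    by (auto simp: abacus_def)
  then show "q < as ! i" using runner_position_eq_iff[OF assms *(2)] by simp
qed (use assms in \<open>auto simp: abacus_def intro!: image_eqI[of _ _ "(i, q)"]\<close>)

lemma card_abacus:
  assumes "length as = t - 1"
  shows "card (abacus t as) = sum_list as"
proof -
  have "inj_on (\<lambda>(i, q). Suc i + q * t) (SIGMA i:{..<t - 1}. {..<as ! i})"
    using runner_position_eq_iff by (auto simp: inj_on_def simp del: add_Suc)
  then have "card (abacus t as) = (\<Sum>i<t - 1. as ! i)"
    unfolding abacus_def by (subst card_image) auto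
  then show ?thesis using assms by (simp add: sum_list_sum_nth atLeast0LessThan)
qed

lemma subtraction_closed_abacus:
  assumes "length as = t - 1"
  shows "subtraction_closed t (abacus t as)"
proof -
  have "x - t \<in> abacus t as" if "x \<in> abacus t as" "t \<le> x" for x
  proof -
    from that obtain i q where *: "x = Suc i + q * t" "i < t - 1" "q < as ! i"
      by (auto simp: abacus_def)
    with that obtain p where "q = Suc p" by (cases q) auto
    with * have "x - t = Suc i + p * t" "p < as ! i" by auto
    then show ?thesis using Suc_mem_abacus_iff[OF *(2)] by metis
  qed
  then show ?thesis by (auto simp: subtraction_closed_def) (auto simp: abacus_def)
qed

lemma abacus_runner_lengths:
  assumes "0 < t" and closed: "subtraction_closed t B"
  shows "abacus t (runner_lengths t B) = B"
proof (rule set_eqI)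
  fix x
  show "x \<in> abacus t (runner_lengths t B) \<longleftrightarrow> x \<in> B"
  proof (cases "x mod t")
    case 0
    have no_multiple: "q * t \<notin> B" for q
    proof (induction q)
      case 0
      show ?case using closed by (simp add: subtraction_closed_def)
    next
      case (Suc q)
      then show ?case using closed by (fastforce simp: subtraction_closed_def)
    qed
    have "x \<notin> B" using no_multiple[of "x div t"] 0 by auto
    moreover have "x \<notin> abacus t (runner_lengths t B)"
    proof
      assume "x \<in> abacus t (runner_lengths t B)"
      then obtain i q where "x = Suc i + q * t" "i < t - 1"
        by (auto simp: abacus_def simp del: add_Suc)
      then show False using 0 runner_position_mod[of i t q] by simp
    qed
    ultimately show ?thesis by simp
  next
    case (Suc i)
    then have "i < t - 1" using mod_less_divisor[OF assms(1), of x] by linarith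
    moreover have "x = Suc i + (x div t) * t" using Suc by (metis add.commute div_mult_mod_eq)
    ultimately show ?thesis
      using Suc_mem_abacus_iff nth_runner_lengths[OF assms] by metis
  qed
qed

lemma runner_lengths_abacus:
  assumes "0 < t" and "length as = t - 1"
  shows "runner_lengths t (abacus t as) = as"
proof (rule nth_equalityI)
  fix i
  assume "i < length (runner_lengths t (abacus t as))"
  then have i: "i < t - 1" by simp
  have "q < runner_lengths t (abacus t as) ! i \<longleftrightarrow> q < as ! i" for q
    using nth_runner_lengths[OF assms(1) subtraction_closed_abacus[OF assms(2)] i]
      Suc_mem_abacus_iff[OF i] by blast
  then show "runner_lengths t (abacus t as) ! i = as ! i"
    by (metis less_irrefl linorder_neqE_nat)
qed (use assms in simp)

definition core_vector :: "nat \<Rightarrow> nat list \<Rightarrow> nat list" where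
  "core_vector t xs = runner_lengths t (first_column_hooks xs)"

lemma bij_betw_core_vector:
  assumes "0 < t"
  shows "bij_betw (core_vector t) {xs. core_partition t xs} {as. length as = t - 1}"
proof -
  have "bij_betw first_column_hooks {xs. core_partition t xs} {B. subtraction_closed t B}"
    unfolding bij_betw_def
  proof
    show "inj_on first_column_hooks {xs. core_partition t xs}"
      using inj_on_first_column_hooks by (rule inj_on_subset) (auto simp: core_partition_def)
    show "first_column_hooks ` {xs. core_partition t xs} = {B. subtraction_closed t B}"
    proof (intro subset_antisym subsetI)
      fix B assume B: "B \<in> {B. subtraction_closed t B}"
      then obtain xs where "is_partition xs" "first_column_hooks xs = B"
        using partition_with_first_column_hooks[of B] by (auto simp: subtraction_closed_def)
      then show "B \<in> first_column_hooks ` {xs. core_partition t xs}"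
        using B core_partition_iff[OF assms] by blast
    qed (auto simp: core_partition_iff[OF assms])
  qed
  moreover have "bij_betw (runner_lengths t) {B. subtraction_closed t B} {as. length as = t - 1}"
    by (rule bij_betw_byWitness[where f' = "abacus t"])
      (auto simp: abacus_runner_lengths runner_lengths_abacus subtraction_closed_abacus assms)
  ultimately have "bij_betw (runner_lengths t \<circ> first_column_hooks)
      {xs. core_partition t xs} {as. length as = t - 1}"
    by (rule bij_betw_trans)
  then show ?thesis by (simp add: core_vector_def[abs_def] comp_def)
qed

lemma sum_list_core_vector:
  assumes "0 < t" and "core_partition t xs"
  shows "sum_list (core_vector t xs) = length xs"
  using card_abacus[of "core_vector t xs" t] abacus_runner_lengths[OF assms(1)]
    card_first_column_hooks assms(2) core_partition_iff[OF assms(1)]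
  by (simp add: core_vector_def)

lemma nth_core_vector_pos_iff:
  assumes "0 < t" and "core_partition t xs" and "i < t - 1"
  shows "0 < core_vector t xs ! i \<longleftrightarrow> Suc i \<in> first_column_hooks xs"
  using nth_runner_lengths[OF assms(1) _ assms(3), of _ 0] assms(2)
    core_partition_iff[OF assms(1)]
  by (simp add: core_vector_def)

section \<open>Counting\<close>

lemma has_number_bij_betw:
  assumes "bij_betw f A B"
  shows "has_number A n \<longleftrightarrow> has_number B n"
  using bij_betw_finite[OF assms] bij_betw_same_card[OF assms] by (simp add: has_number_def)

text \<open>Counting cores with a property thus means counting vectors, once the property is expressed
  through the vector.\<close>

lemma has_number_core_vectors:
  assumes "0 < t"
    and "\<And>xs. core_partition t xs \<Longrightarrow> P xs \<longleftrightarrow> Q (core_vector t xs)"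
  shows "has_number {xs. core_partition t xs \<and> P xs} n \<longleftrightarrow>
    has_number {as. length as = t - 1 \<and> Q as} n"
proof -
  have *: "bij_betw (core_vector t) {xs. core_partition t xs} {as. length as = t - 1}"
    by (rule bij_betw_core_vector[OF assms(1)])
  have "core_vector t ` {xs. core_partition t xs \<and> P xs} = {as. length as = t - 1 \<and> Q as}"
  proof (intro subset_antisym subsetI)
    fix as
    assume "as \<in> core_vector t ` {xs. core_partition t xs \<and> P xs}"
    then show "as \<in> {as. length as = t - 1 \<and> Q as}"
      using assms(2) by (auto simp: core_vector_def)
  next
    fix as
    assume as: "as \<in> {as. length as = t - 1 \<and> Q as}"
    then have "as \<in> core_vector t ` {xs. core_partition t xs}"
      by (simp add: bij_betw_imp_surj_on[OF *])
    then obtain xs where "core_partition t xs" "core_vector t xs = as"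
      by blast
    then show "as \<in> core_vector t ` {xs. core_partition t xs \<and> P xs}"
      using as assms(2) by blast
  qed
  then have "bij_betw (core_vector t) {xs. core_partition t xs \<and> P xs}
      {as. length as = t - 1 \<and> Q as}"
    by (intro bij_betw_subset[OF *]) auto
  then show ?thesis by (rule has_number_bij_betw)
qed

text \<open>
  Stars and bars.  The formula also covers \<open>m = 0\<close>: with truncated subtraction it gives 1 for \<open>N = 0\<close>
  and 0 for \<open>N > 0\<close>.
\<close>

lemma has_number_sum_lists:
  "has_number {as::nat list. length as = m \<and> sum_list as = N} ((N + m - 1) choose N)"
proof -
  have "{as::nat list. length as = m \<and> sum_list as = N}
      \<subseteq> {as. set as \<subseteq> {..N} \<and> length as = m}"
    using member_le_sum_list by fastforce
  then have "finite {as::nat list. length as = m \<and> sum_list as = N}"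
    by (rule finite_subset) (simp add: finite_lists_length_eq)
  then show ?thesis using card_length_sum_list[of m N] by (simp add: has_number_def)
qed

text \<open>An additional entry takes up the slack.\<close>

lemma has_number_sum_lists_le:
  "has_number {as::nat list. length as = m \<and> sum_list as \<le> N} ((N + m) choose N)"
proof -
  have "bij_betw tl {as::nat list. length as = Suc m \<and> sum_list as = N}
      {as. length as = m \<and> sum_list as \<le> N}"
    by (rule bij_betw_byWitness[where f' = "\<lambda>as. (N - sum_list as) # as"])
      (auto simp: length_Suc_conv)
  then show ?thesis
    using has_number_sum_lists[of "Suc m" N] has_number_bij_betw by fastforce
qed

lemma has_number_positive_prefix:
  assumes "j \<le> m"
  shows "has_number {as. length as = m \<and> sum_list as = N + j \<and> (\<forall>i < j. 0 < as ! i)}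
    ((N + m - 1) choose N)"
proof -
  have "bij_betw (\<lambda>bs. map Suc (take j bs) @ drop j bs)
     {bs. length bs = m \<and> sum_list bs = N}
     {as. length as = m \<and> sum_list as = N + j \<and> (\<forall>i < j. 0 < as ! i)}"
  proof (rule bij_betw_byWitness[where
        f' = "\<lambda>as. map (\<lambda>x. x - 1) (take j as) @ drop j as"]; safe)
    fix bs :: "nat list"
    assume "m = length bs" "N = sum_list bs"
    have "sum_list (take j bs @ drop j bs) = sum_list bs" by simp
    then show "sum_list (map Suc (take j bs) @ drop j bs) = sum_list bs + j"
      using assms \<open>m = length bs\<close> sum_list_Suc[of "\<lambda>x. x" "take j bs"]
      unfolding sum_list_append by simp
  next
    fix as :: "nat list"
    assume *: "m = length as" "sum_list as = N + j" "\<forall>i < j. 0 < as ! i"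
    have "map Suc (map (\<lambda>x. x - 1) (take j as)) = take j as"
      using * by (auto intro!: nth_equalityI)
    then show "map Suc (take j (map (\<lambda>x. x - 1) (take j as) @ drop j as))
        @ drop j (map (\<lambda>x. x - 1) (take j as) @ drop j as) = as"
      using * assms by (simp add: min_def)
  next
    fix as :: "nat list"
    assume *: "m = length as" "sum_list as = N + j" "\<forall>i < j. 0 < as ! i"
    have "map Suc (map (\<lambda>x. x - 1) (take j as)) = take j as"
      using * by (auto intro!: nth_equalityI)
    then have "sum_list (take j as) = sum_list (map (\<lambda>x. x - 1) (take j as)) + j"
      using * assms sum_list_Suc[of "\<lambda>x. x" "map (\<lambda>x. x - 1) (take j as)"] by simp
    moreover have "sum_list (take j as @ drop j as) = N + j" using * by simp
    ultimately show "sum_list (map (\<lambda>x. x - 1) (take j as) @ drop j as) = N"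
      unfolding sum_list_append by simp
  qed (use assms in \<open>auto simp: nth_append min_def comp_def\<close>)
  then show ?thesis
    using has_number_sum_lists has_number_bij_betw by blast
qed

lemma has_number_positive_prefix_then_zero:
  assumes "j < m"
  shows "has_number
    {as. length as = m \<and> sum_list as = N + j \<and> (\<forall>i < j. 0 < as ! i) \<and> as ! j = 0}
    ((N + m - 2) choose N)"
proof -
  have bij: "bij_betw (\<lambda>bs. take j bs @ 0 # drop j bs)
     {bs. length bs = m - 1 \<and> sum_list bs = N + j \<and> (\<forall>i < j. 0 < bs ! i)}
     {as. length as = m \<and> sum_list as = N + j \<and> (\<forall>i < j. 0 < as ! i) \<and> as ! j = 0}"
  proof (rule bij_betw_byWitness[where f' = "\<lambda>as. take j as @ drop (Suc j) as"]; safe)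
    fix bs :: "nat list"
    assume "sum_list bs = N + j"
    moreover have "sum_list (take j bs @ drop j bs) = sum_list bs" by simp
    ultimately show "sum_list (take j bs @ 0 # drop j bs) = N + j"
      unfolding sum_list_append by simp
  next
    fix as :: "nat list"
    assume "m = length as" "as ! j = 0"
    then have as: "as = take j as @ 0 # drop (Suc j) as"
      using id_take_nth_drop[of j as] assms by simp
    then show "take j (take j as @ drop (Suc j) as) @ 0 # drop j (take j as @ drop (Suc j) as) = as"
      using \<open>m = length as\<close> assms by (simp add: min_def)
    assume "sum_list as = N + j"
    moreover have "sum_list as = sum_list (take j as) + sum_list (drop (Suc j) as)"
      by (subst as) simp
    ultimately show "sum_list (take j as @ drop (Suc j) as) = N + j"
      by simp
  qed (use assms in \<open>auto simp: nth_append min_def\<close>)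
  have "N + m - 2 = N + (m - 1) - 1" using assms by simp
  then show ?thesis
    using has_number_positive_prefix[of j "m - 1" N] has_number_bij_betw[OF bij] assms
    by simp
qed

lemma has_number_zero_prefix_then_positive:
  assumes "k < m"
  shows "has_number
    {as. length as = m \<and> sum_list as = Suc N \<and> (\<forall>i < k. as ! i = 0) \<and> 0 < as ! k}
    ((N + (m - k) - 1) choose N)"
proof -
  have bij: "bij_betw (\<lambda>bs. replicate k 0 @ bs)
     {bs. length bs = m - k \<and> sum_list bs = N + 1 \<and> (\<forall>i < 1. 0 < bs ! i)}
     {as. length as = m \<and> sum_list as = Suc N \<and> (\<forall>i < k. as ! i = 0) \<and> 0 < as ! k}"
  proof (rule bij_betw_byWitness[where f' = "drop k"]; safe)
    fix as :: "nat list"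
    assume "m = length as" "\<forall>i < k. as ! i = 0"
    then have "take k as = replicate k 0"
      using assms by (auto intro!: nth_equalityI)
    then show as: "replicate k 0 @ drop k as = as"
      by (metis append_take_drop_id)
    assume "sum_list as = Suc N"
    moreover have "sum_list as = sum_list (replicate k 0 @ drop k as)" using as by simp
    ultimately show "sum_list (drop k as) = N + 1" by (simp add: sum_list_replicate)
  qed (use assms in \<open>auto simp: nth_append\<close>)
  then show ?thesis
    using has_number_positive_prefix[of 1 "m - k" N] has_number_bij_betw[OF bij] assms
    by simp
qed

section \<open>Cores with prescribed parts\<close>

lemma length_filter_greater_one:
  assumes "is_partition xs"
  shows "length (filter (\<lambda>x. 1 < x) xs) + count_list xs 1 = length xs"
  using assms by (induction xs) auto

text \<open>
  Since \<open>t\<close> is not a first-column hook length, there are at most \<open>t - 1\<close> parts equal to 1.  For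
  \<open>j = t - 1\<close> there is no runner number \<open>j\<close>, and the absence of \<open>Suc j = t\<close> is automatic.
\<close>

lemma core_count_one_iff:
  assumes "0 < t" and core: "core_partition t xs"
  shows "length (filter (\<lambda>x. 1 < x) xs) = l \<and> count_list xs 1 = j \<longleftrightarrow>
    j \<le> t - 1 \<and> sum_list (core_vector t xs) = l + j \<and> (\<forall>i < j. 0 < core_vector t xs ! i)
      \<and> (j < t - 1 \<longrightarrow> core_vector t xs ! j = 0)"
proof -
  let ?B = "first_column_hooks xs"
  have part: "is_partition xs" and closed: "subtraction_closed t ?B"
    using core core_partition_iff[OF assms(1)] by auto
  have "t \<notin> ?B"
    using closed by (fastforce simp: subtraction_closed_def)
  have "{1..j} \<subseteq> ?B \<longleftrightarrow> (\<forall>i < j. Suc i \<in> ?B)"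
    by (auto simp: subset_eq) (metis Suc_le_eq Suc_pred)
  moreover have "j \<le> t - 1" if "\<forall>i < j. Suc i \<in> ?B"
    using that \<open>t \<notin> ?B\<close> assms(1) by (metis One_nat_def Suc_pred linorder_not_le)
  moreover have "Suc j \<notin> ?B" if "j = t - 1"
    using that \<open>t \<notin> ?B\<close> assms(1) by simp
  ultimately have "count_list xs 1 = j \<longleftrightarrow> j \<le> t - 1 \<and> (\<forall>i < j. 0 < core_vector t xs ! i)
      \<and> (j < t - 1 \<longrightarrow> core_vector t xs ! j = 0)"
    using count_one_eq_iff[OF part, of j] nth_core_vector_pos_iff[OF assms]
    by (smt (verit) le_neq_implies_less less_le_trans not_gr_zero)
  then show ?thesis
    using length_filter_greater_one[OF part] sum_list_core_vector[OF assms] by auto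
qed

text \<open>
  The minimum of the first-column hook lengths is less than \<open>t\<close>, as otherwise subtracting \<open>t\<close> would
  give a smaller element.  So it is the first position of the first nonempty runner.
\<close>

lemma core_Min_iff:
  assumes "0 < t" and core: "core_partition t xs" and "xs \<noteq> []"
  shows "Min (set xs) = Suc k \<longleftrightarrow>
    k < t - 1 \<and> (\<forall>i < k. core_vector t xs ! i = 0) \<and> 0 < core_vector t xs ! k"
proof -
  let ?B = "first_column_hooks xs"
  have part: "is_partition xs" and closed: "subtraction_closed t ?B"
    using core core_partition_iff[OF assms(1)] by auto
  have "?B \<noteq> {}" using assms(3) by (auto simp: first_column_hooks_def)
  then have "Min (set xs) = Suc k \<longleftrightarrow> Suc k \<in> ?B \<and> (\<forall>b \<in> ?B. Suc k \<le> b)"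
    using Min_first_column_hooks[OF part assms(3)] by (metis Min_eq_iff finite_first_column_hooks)
  also have "\<dots> \<longleftrightarrow> Suc k \<in> ?B \<and> (\<forall>i < k. Suc i \<notin> ?B)"
    using closed by (auto simp: subtraction_closed_def) (metis Suc_le_eq not0_implies_Suc not_less_eq_eq)
  also have "\<dots> \<longleftrightarrow> k < t - 1 \<and> Suc k \<in> ?B \<and> (\<forall>i < k. Suc i \<notin> ?B)"
  proof -
    have "k < t - 1" if "Suc k \<in> ?B" "\<forall>i < k. Suc i \<notin> ?B"
    proof (rule ccontr)
      assume "\<not> k < t - 1"
      then have "Suc k - t \<in> ?B" using closed that(1) by (auto simp: subtraction_closed_def)
      moreover from this have "Suc k - t \<noteq> 0" using closed by (metis subtraction_closed_def)
      then obtain i where "Suc k - t = Suc i" using not0_implies_Suc by blast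
      moreover from this have "i < k" using assms(1) by simp
      ultimately show False using that(2) by simp
    qed
    then show ?thesis by blast
  qed
  also have "\<dots> \<longleftrightarrow>
    k < t - 1 \<and> (\<forall>i < k. core_vector t xs ! i = 0) \<and> 0 < core_vector t xs ! k"
    using nth_core_vector_pos_iff[OF assms(1,2)] by (metis less_trans not_gr_zero)
  finally show ?thesis .
qed

theorem theorem2p4:
  fixes t l :: nat
  assumes "0 < t" and "0 < l"
  shows "has_number {xs. core_partition t xs \<and> length xs = l} (ibinom (int l + int t - 2) l)
    \<and> has_number {xs. core_partition t xs \<and> length xs \<le> l} (ibinom (int l + int t - 1) l)
    \<and> (\<forall>j::nat. has_number
          {xs. core_partition t xs \<and> length (filter (\<lambda>x. 1 < x) xs) = l \<and> count_list xs 1 = j}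
          (if int j \<le> int t - 2 then ibinom (int l + int t - 3) l
           else if int j = int t - 1 then ibinom (int l + int t - 2) l
           else 0))
    \<and> (\<forall>i::nat. 0 < i \<longrightarrow> has_number
          {xs. core_partition t xs \<and> length xs = l \<and> Min (set xs) = i}
          (ibinom (int l + int t - int i - 2) (l - 1)))"
proof (intro conjI allI impI)
  note vectors = has_number_core_vectors[OF \<open>0 < t\<close>]
  have ibinom_nat: "ibinom (int n) k = n choose k" for n k
    by (simp add: ibinom_def binomial_eq_0)
  have ibinom_minus_2: "ibinom (int l + int t - 2) l = (l + (t - 1) - 1) choose l"
    using assms ibinom_nat[of "l + (t - 1) - 1" l] by (simp add: of_nat_diff)
  show "has_number {xs. core_partition t xs \<and> length xs = l} (ibinom (int l + int t - 2) l)"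
    unfolding ibinom_minus_2
    using vectors[of "\<lambda>xs. length xs = l" "\<lambda>as. sum_list as = l"]
      sum_list_core_vector[OF \<open>0 < t\<close>] has_number_sum_lists[of "t - 1" l] by simp
  have "ibinom (int l + int t - 1) l = (l + (t - 1)) choose l"
    using assms ibinom_nat[of "l + (t - 1)" l] by (simp add: of_nat_diff)
  then show "has_number {xs. core_partition t xs \<and> length xs \<le> l} (ibinom (int l + int t - 1) l)"
    using vectors[of "\<lambda>xs. length xs \<le> l" "\<lambda>as. sum_list as \<le> l"]
      sum_list_core_vector[OF \<open>0 < t\<close>] has_number_sum_lists_le[of "t - 1" l] by simp
  {
    fix j :: nat
    have "has_number
        {as. length as = t - 1 \<and> (j \<le> t - 1 \<and> sum_list as = l + j \<and> (\<forall>i < j. 0 < as ! i)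
          \<and> (j < t - 1 \<longrightarrow> as ! j = 0))}
        (if int j \<le> int t - 2 then ibinom (int l + int t - 3) l
         else if int j = int t - 1 then ibinom (int l + int t - 2) l
         else 0)"
    proof -
      consider "j < t - 1" | "j = t - 1" | "t - 1 < j" by linarith
      then show ?thesis
      proof cases
        case 1
        then have "ibinom (int l + int t - 3) l = (l + (t - 1) - 2) choose l"
          using assms ibinom_nat[of "l + (t - 1) - 2" l] by (simp add: of_nat_diff)
        then show ?thesis
          using has_number_positive_prefix_then_zero[of j "t - 1" l] 1 by auto
      next
        case 2
        then show ?thesis
          using has_number_positive_prefix[of j "t - 1" l] assms ibinom_minus_2
          by (simp add: of_nat_diff)
      next
        case 3
        then have "\<not> int j \<le> int t - 2" and "int j \<noteq> int t - 1" by linarith+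
        then show ?thesis using 3 by (simp add: has_number_def)
      qed
    qed
    then show "has_number
        {xs. core_partition t xs \<and> length (filter (\<lambda>x. 1 < x) xs) = l \<and> count_list xs 1 = j}
        (if int j \<le> int t - 2 then ibinom (int l + int t - 3) l
         else if int j = int t - 1 then ibinom (int l + int t - 2) l
         else 0)"
      by (subst vectors) (rule core_count_one_iff[OF \<open>0 < t\<close>], assumption)
  next
    fix i :: nat
    assume "0 < i"
    then obtain k where i: "i = Suc k" using gr0_implies_Suc by blast
    have "has_number
        {as. length as = t - 1 \<and> (sum_list as = l \<and> k < t - 1 \<and> (\<forall>i < k. as ! i = 0)
          \<and> 0 < as ! k)}
        (ibinom (int l + int t - int i - 2) (l - 1))"
    proof (cases "k < t - 1")
      case True
      then have "int l + int t - int i - 2 = int (l - 1 + (t - 1 - k) - 1)"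
        using assms i by linarith
      then have "ibinom (int l + int t - int i - 2) (l - 1)
          = (l - 1 + (t - 1 - k) - 1) choose (l - 1)"
        by (simp only: ibinom_nat)
      then show ?thesis
        using has_number_zero_prefix_then_positive[OF True, of "l - 1"] True assms by simp
    next
      case False
      then have "int l + int t - int i - 2 < int (l - 1)" using i assms by linarith
      then show ?thesis using False by (simp add: has_number_def ibinom_def)
    qed
    moreover have "length xs = l \<and> Min (set xs) = i \<longleftrightarrow>
        sum_list (core_vector t xs) = l \<and> k < t - 1 \<and> (\<forall>i < k. core_vector t xs ! i = 0)
          \<and> 0 < core_vector t xs ! k" if core: "core_partition t xs" for xs
    proof (cases "xs = []")
      case False
      then show ?thesis
        using core_Min_iff[OF \<open>0 < t\<close> core] sum_list_core_vector[OF \<open>0 < t\<close> core] i by metis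
    next
      case True
      then show ?thesis
        using assms sum_list_core_vector[OF \<open>0 < t\<close> core] by (metis list.size(3) less_irrefl)
    qed
    ultimately show "has_number {xs. core_partition t xs \<and> length xs = l \<and> Min (set xs) = i}
        (ibinom (int l + int t - int i - 2) (l - 1))"
      by (subst vectors)
  }
qed

end
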